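(* Let $\mathbf{s}_1,\dots,\mathbf{s}_m\in\mathbb{R}^n$ be in general linear position, $m\le n+1$, and let $t_1,\dots,t_m\in\mathbb{R}$. Let $\mathbf{u},\mathbf{v},\mathbf{w}_1,\dots,\mathbf{w}_k\in\mathbb{R}^n$ and $\alpha,\beta\in\mathbb{R}$ be as defined in the context. Then the set $$\mathfrak{X}:=\bigl\{(b,\mathbf{x})\in\mathbb{R}\times\mathbb{R}^n\mid\lVert\mathbf{s}_i-\mathbf{x}\rVert^2=(t_i-b)^2\text{ for }i=1,\dots,m\bigr\}$$ is equal to $$\Bigl\{(b,\mathbf{x})\in\mathbb{R}\times\mathbb{R}^n\ \Big|\ \mathbf{x}=\mathbf{v}+b\mathbf{u}+\sum_{j=1}^k y_j\mathbf{w}_j\text{ with }y_1,\dots,y_k\in\mathbb{R}\text{ and }g(b,y_1,\dots,y_k)=0\Bigr\},$$ where $$g(b,y_1,\dots,y_k):=\sum_{j=1}^k y_j^2+\bigl(\lVert\mathbf{u}\rVert^2-1\bigr)b^2+2\bigl(\langle\mathbf{u},\mathbf{v}\rangle-\alpha\bigr)b+\lVert\mathbf{v}\rVert^2-\beta.$$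
   Context: $n,m\ge1$ are integers; $\langle\cdot,\cdot\rangle$ and $\lVert\cdot\rVert$ are the Euclidean inner product and norm on $\mathbb{R}^n$. For $m\le n+1$, points $\mathbf{s}_1,\dots,\mathbf{s}_m$ are in general linear position if their affine span has dimension $m-1$. Auxiliary data: $U\subseteq\mathbb{R}^n$ is the linear span of the $\mathbf{s}_i-\mathbf{s}_1$ ($2\le i\le m$), which has dimension $m-1$; $k:=n+1-m$; $\mathbf{w}_1,\dots,\mathbf{w}_k$ is an orthonormal basis of $U^\perp$; $\gamma_j:=\langle\mathbf{s}_i,\mathbf{w}_j\rangle$, which does not depend on $i$. $(\mathbf{v},\beta)\in\mathbb{R}^n\times\mathbb{R}$ is the unique pair with $2\langle\mathbf{s}_i,\mathbf{v}\rangle-\beta=\lVert\mathbf{s}_i\rVert^2-t_i^2$ for all $i$ and $\langle\mathbf{v},\mathbf{w}_j\rangle=\gamma_j$ for all $j$. $(\mathbf{u},\alpha)\in\mathbb{R}^n\times\mathbb{R}$ is the unique pair with $\langle\mathbf{s}_i,\mathbf{u}\rangle-\alpha=t_i$ for all $i$ and $\langle\mathbf{u},\mathbf{w}_j\rangle=0$ for all $j$. *)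

theory Defs
  imports "HOL-Analysis.Analysis"
begin

text \<open>Families \<open>s\<^sub>1,\<dots>,s\<^sub>m\<close> are functions on \<^typ>\<open>nat\<close> of which only the
  values on \<open>{1..m}\<close> matter; \<open>n\<close> is \<open>CARD('n)\<close>.\<close>

definition general_linear_position :: "nat \<Rightarrow> (nat \<Rightarrow> real ^ 'n) \<Rightarrow> bool" where
  "general_linear_position m s \<longleftrightarrow> aff_dim (affine hull (s ` {1..m})) = int m - 1"

definition direction_space :: "nat \<Rightarrow> (nat \<Rightarrow> real ^ 'n) \<Rightarrow> (real ^ 'n) set" where
  "direction_space m s = span ((\<lambda>i. s i - s 1) ` {2..m})"

definition orthonormal_basis :: "nat \<Rightarrow> (nat \<Rightarrow> real ^ 'n) \<Rightarrow> (real ^ 'n) set \<Rightarrow> bool" where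
  "orthonormal_basis k w V \<longleftrightarrow>
     (\<forall>i\<in>{1..k}. \<forall>j\<in>{1..k}. w i \<bullet> w j = (if i = j then 1 else 0)) \<and>
     span (w ` {1..k}) = V"

text \<open>The index 1 is an arbitrary choice; see \<open>offset_eq\<close> below.\<close>

definition offset :: "(nat \<Rightarrow> real ^ 'n) \<Rightarrow> (nat \<Rightarrow> real ^ 'n) \<Rightarrow> nat \<Rightarrow> real" where
  "offset s w j = s 1 \<bullet> w j"

definition is_v_pair ::
  "nat \<Rightarrow> nat \<Rightarrow> (nat \<Rightarrow> real ^ 'n) \<Rightarrow> (nat \<Rightarrow> real) \<Rightarrow> (nat \<Rightarrow> real ^ 'n) \<Rightarrow> real ^ 'n \<Rightarrow> real \<Rightarrow> bool" where
  "is_v_pair m k s t w v \<beta> \<longleftrightarrow>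
     (\<forall>i\<in>{1..m}. 2 * (s i \<bullet> v) - \<beta> = (norm (s i))\<^sup>2 - (t i)\<^sup>2) \<and>
     (\<forall>j\<in>{1..k}. v \<bullet> w j = offset s w j)"

definition is_u_pair ::
  "nat \<Rightarrow> nat \<Rightarrow> (nat \<Rightarrow> real ^ 'n) \<Rightarrow> (nat \<Rightarrow> real) \<Rightarrow> (nat \<Rightarrow> real ^ 'n) \<Rightarrow> real ^ 'n \<Rightarrow> real \<Rightarrow> bool" where
  "is_u_pair m k s t w u \<alpha> \<longleftrightarrow>
     (\<forall>i\<in>{1..m}. s i \<bullet> u - \<alpha> = t i) \<and>
     (\<forall>j\<in>{1..k}. u \<bullet> w j = 0)"

text \<open>The descriptions below are well defined by \<open>ex1_v_pair\<close> and \<open>ex1_u_pair\<close>.\<close>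

definition v_pair ::
  "nat \<Rightarrow> nat \<Rightarrow> (nat \<Rightarrow> real ^ 'n) \<Rightarrow> (nat \<Rightarrow> real) \<Rightarrow> (nat \<Rightarrow> real ^ 'n) \<Rightarrow> (real ^ 'n) \<times> real" where
  "v_pair m k s t w = (THE (v, \<beta>). is_v_pair m k s t w v \<beta>)"

definition u_pair ::
  "nat \<Rightarrow> nat \<Rightarrow> (nat \<Rightarrow> real ^ 'n) \<Rightarrow> (nat \<Rightarrow> real) \<Rightarrow> (nat \<Rightarrow> real ^ 'n) \<Rightarrow> (real ^ 'n) \<times> real" where
  "u_pair m k s t w = (THE (u, \<alpha>). is_u_pair m k s t w u \<alpha>)"

definition sol_set :: "nat \<Rightarrow> (nat \<Rightarrow> real ^ 'n) \<Rightarrow> (nat \<Rightarrow> real) \<Rightarrow> (real \<times> (real ^ 'n)) set" where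
  "sol_set m s t = {(b, x). \<forall>i\<in>{1..m}. (norm (s i - x))\<^sup>2 = (t i - b)\<^sup>2}"

definition quadric ::
  "nat \<Rightarrow> real ^ 'n \<Rightarrow> real \<Rightarrow> real ^ 'n \<Rightarrow> real \<Rightarrow> real \<Rightarrow> (nat \<Rightarrow> real) \<Rightarrow> real" where
  "quadric k u \<alpha> v \<beta> b y =
     (\<Sum>j=1..k. (y j)\<^sup>2) + ((norm u)\<^sup>2 - 1) * b\<^sup>2 + 2 * (u \<bullet> v - \<alpha>) * b + (norm v)\<^sup>2 - \<beta>"

lemma orthonormal_basis_perp:
  assumes "orthonormal_basis k w (orthogonal_comp (direction_space m s))"
    and "i \<in> {1..m}" "j \<in> {1..k}"
  shows "(s i - s 1) \<bullet> w j = 0"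
proof (cases "i = 1")
  case False
  then have "s i - s 1 \<in> direction_space m s"
    using assms(2) by (auto simp: direction_space_def intro!: span_base)
  moreover have "w j \<in> orthogonal_comp (direction_space m s)"
    using assms(1,3) span_base[of "w j" "w ` {1..k}"] by (simp add: orthonormal_basis_def)
  ultimately show ?thesis
    by (auto simp: orthogonal_comp_def orthogonal_def inner_commute)
qed simp

lemma offset_eq:
  assumes "orthonormal_basis k w (orthogonal_comp (direction_space m s))"
    and "i \<in> {1..m}" "j \<in> {1..k}"
  shows "offset s w j = s i \<bullet> w j"
  using orthonormal_basis_perp[OF assms] by (simp add: offset_def inner_diff_left)

lemma general_linear_position_independent:
  fixes s :: "nat \<Rightarrow> real ^ 'n"
  assumes "m \<ge> 1" "general_linear_position m s"
  shows "independent ((\<lambda>i. s i - s 1) ` {2..m})" "inj_on (\<lambda>i. s i - s 1) {2..m}"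
proof -
  let ?E = "(\<lambda>i. s i - s 1) ` {2..m}"
  have ins: "(\<lambda>x. - s 1 + x) ` s ` {1..m} = insert 0 ?E"
  proof -
    have "{1..m} = insert 1 {2..m}" using assms(1) by auto
    then show ?thesis by (simp add: image_image)
  qed
  have "s 1 \<in> affine hull (s ` {1..m})"
    using assms(1) by (auto intro: hull_inc)
  then have "aff_dim (s ` {1..m}) = int (dim ((\<lambda>x. - s 1 + x) ` s ` {1..m}))"
    by (rule aff_dim_eq_dim)
  then have dim: "dim ?E = m - 1"
    using assms unfolding ins by (simp add: general_linear_position_def dim_insert span_zero)
  have card: "card ?E \<le> m - 1"
    using card_image_le[of "{2..m}" "\<lambda>i. s i - s 1"] by simp
  show "independent ?E"
    by (rule card_le_dim_spanning[of _ "span ?E"]) (use dim card in \<open>auto simp: span_superset\<close>)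
  then have "card ?E = m - 1" using dim dim_eq_card_independent by metis
  then show "inj_on (\<lambda>i. s i - s 1) {2..m}"
    by (intro eq_card_imp_inj_on) auto
qed

lemma ex1_linear_system:
  fixes s w :: "nat \<Rightarrow> real ^ 'n" and c d :: "nat \<Rightarrow> real"
  assumes m: "m \<ge> 1" and gp: "general_linear_position m s"
    and ob: "orthonormal_basis k w (orthogonal_comp (direction_space m s))"
  shows "\<exists>!(x, a). (\<forall>i\<in>{1..m}. s i \<bullet> x - a = c i) \<and> (\<forall>j\<in>{1..k}. x \<bullet> w j = d j)"
proof -
  let ?P = "\<lambda>x a. (\<forall>i\<in>{1..m}. s i \<bullet> x - a = c i) \<and> (\<forall>j\<in>{1..k}. x \<bullet> w j = d j)"
  let ?e = "\<lambda>i. s i - s 1"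
  have on: "w i \<bullet> w j = (if i = j then 1 else 0)" if "i \<in> {1..k}" "j \<in> {1..k}" for i j
    using ob that by (simp add: orthonormal_basis_def)
  note ind = general_linear_position_independent[OF m gp]
  obtain g :: "real ^ 'n \<Rightarrow> real" where g: "linear g"
    "\<forall>z \<in> ?e ` {2..m}. g z = c (inv_into {2..m} ?e z) - c 1"
    using linear_independent_extend[OF ind(1), of "\<lambda>z. c (inv_into {2..m} ?e z) - c 1"]
    by (elim exE conjE) (rule that)
  define x1 where "x1 = adjoint g 1"
  have x1: "?e i \<bullet> x1 = c i - c 1" if "i \<in> {1..m}" for i
  proof (cases "i = 1")
    case False
    then have i: "i \<in> {2..m}" using that by auto
    have "?e i \<bullet> x1 = g (?e i)"
      using adjoint_works[OF g(1), of "?e i" 1] by (simp add: x1_def)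
    also have "\<dots> = c i - c 1"
      using bspec[OF g(2) imageI[OF i]] inv_into_f_f[OF ind(2) i] by simp
    finally show ?thesis .
  qed simp
  define x where "x = x1 + (\<Sum>j=1..k. (d j - x1 \<bullet> w j) *\<^sub>R w j)"
  have ex: "?e i \<bullet> x = c i - c 1" if "i \<in> {1..m}" for i
    using x1[OF that] orthonormal_basis_perp[OF ob that]
    by (simp add: x_def inner_add_right inner_sum_right)
  have ew: "x \<bullet> w j = d j" if "j \<in> {1..k}" for j
  proof -
    have "(\<Sum>i=1..k. (d i - x1 \<bullet> w i) * (w i \<bullet> w j)) = (\<Sum>i=1..k. if i = j then d i - x1 \<bullet> w i else 0)"
      by (rule sum.cong) (use on that in auto)
    also have "\<dots> = d j - x1 \<bullet> w j" using that by simp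
    finally show ?thesis by (simp add: x_def inner_add_left inner_sum_left)
  qed
  have P: "?P x (s 1 \<bullet> x - c 1)"
  proof (intro conjI ballI)
    show "s i \<bullet> x - (s 1 \<bullet> x - c 1) = c i" if "i \<in> {1..m}" for i
      using ex[OF that] by (simp add: inner_diff_left)
  qed (rule ew)
  have uniq: "y = x \<and> a = s 1 \<bullet> x - c 1" if Q: "?P y a" for y a
  proof -
    have e0: "?e i \<bullet> (y - x) = 0" if "i \<in> {1..m}" for i
    proof -
      have "s i \<bullet> y - a = c i" "s 1 \<bullet> y - a = c 1" using Q that m by auto
      then show ?thesis using ex[OF that] by (simp add: inner_diff_left inner_diff_right)
    qed
    have "y - x \<in> orthogonal_comp (direction_space m s)"
    proof -
      have "orthogonal (y - x) z" if "z \<in> direction_space m s" for z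
        using that unfolding direction_space_def
        by (rule orthogonal_to_span) (use e0 in \<open>auto simp: orthogonal_def inner_commute\<close>)
      then show ?thesis by (auto simp: orthogonal_comp_def orthogonal_commute)
    qed
    then have "y - x \<in> span (w ` {1..k})" using ob by (simp add: orthonormal_basis_def)
    then have "orthogonal (y - x) (y - x)"
      by (rule orthogonal_to_span) (use Q ew in \<open>auto simp: orthogonal_def inner_diff_left\<close>)
    then have "y = x" by (simp add: orthogonal_def)
    moreover have "s 1 \<bullet> y - a = c 1" using Q m by auto
    ultimately show ?thesis by simp
  qed
  show ?thesis
  proof (rule ex1I[of _ "(x, s 1 \<bullet> x - c 1)"])
    show "case (x, s 1 \<bullet> x - c 1) of (x, a) \<Rightarrow> ?P x a"
      unfolding case_prod_conv by (rule P)
  next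
    fix q assume "case q of (x, a) \<Rightarrow> ?P x a"
    then have "?P (fst q) (snd q)" unfolding case_prod_unfold .
    from uniq[OF this] show "q = (x, s 1 \<bullet> x - c 1)" by (simp only: prod_eq_iff fst_conv snd_conv)
  qed
qed

lemma ex1_u_pair:
  assumes "m \<ge> 1" "general_linear_position m s"
    and "orthonormal_basis k w (orthogonal_comp (direction_space m s))"
  shows "\<exists>!(u, \<alpha>). is_u_pair m k s t w u \<alpha>"
  unfolding is_u_pair_def by (rule ex1_linear_system[OF assms])

lemma ex1_v_pair:
  assumes "m \<ge> 1" "general_linear_position m s"
    and "orthonormal_basis k w (orthogonal_comp (direction_space m s))"
  shows "\<exists>!(v, \<beta>). is_v_pair m k s t w v \<beta>"
proof -
  define P where "P x a \<longleftrightarrow>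
    (\<forall>i\<in>{1..m}. s i \<bullet> x - a = ((norm (s i))\<^sup>2 - (t i)\<^sup>2) / 2) \<and>
    (\<forall>j\<in>{1..k}. x \<bullet> w j = offset s w j)" for x a
  have eq: "is_v_pair m k s t w v \<beta> \<longleftrightarrow> P v (\<beta> / 2)" for v \<beta>
    unfolding is_v_pair_def P_def by (auto simp: field_simps)
  have "\<exists>!(x, a). P x a"
    unfolding P_def by (rule ex1_linear_system[OF assms])
  then obtain p where p: "case_prod P p" and uniq: "\<And>q. case_prod P q \<Longrightarrow> q = p"
    by blast
  show ?thesis
  proof (rule ex1I[of _ "(fst p, 2 * snd p)"])
    show "case (fst p, 2 * snd p) of (v, \<beta>) \<Rightarrow> is_v_pair m k s t w v \<beta>"
      using p by (simp add: eq case_prod_unfold)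
  next
    fix q assume "case q of (v, \<beta>) \<Rightarrow> is_v_pair m k s t w v \<beta>"
    then have "(fst q, snd q / 2) = p"
      by (intro uniq) (simp add: eq case_prod_unfold)
    then show "q = (fst p, 2 * snd p)"
      by (auto simp: prod_eq_iff)
  qed
qed

end

theory Submission
  imports Defs
begin

text \<open>For \<open>x = v + b u + z\<close> with \<open>z\<close> in the span of the \<open>w\<^sub>j\<close>, each residual
  \<open>\<parallel>s\<^sub>i - x\<parallel>\<^sup>2 - (t\<^sub>i - b)\<^sup>2\<close> equals \<open>g(b, y)\<close>: the defining equations of \<open>v\<close> and \<open>u\<close>
  eliminate everything depending on \<open>i\<close>, and the cross terms \<open>2 y\<^sub>j \<gamma>\<^sub>j\<close> of \<open>\<parallel>x\<parallel>\<^sup>2\<close> and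
  \<open>2 \<langle>s\<^sub>i, x\<rangle>\<close> cancel. Conversely, for a solution \<open>(b, x)\<close> the number
  \<open>\<langle>s\<^sub>i, x - v - b u\<rangle>\<close> does not depend on \<open>i\<close>, so \<open>x - v - b u\<close> is orthogonal to \<open>U\<close>.\<close>

text \<open>Unique existence turns the definite description \<open>v_pair\<close> into its defining
  equations, the form in which \<open>v\<close> and \<open>\<beta>\<close> enter the computations
  below.\<close>

lemma is_v_pair_v_pair:
  assumes "m \<ge> 1" "general_linear_position m s"
    and "orthonormal_basis k w (orthogonal_comp (direction_space m s))"
    and "(v, \<beta>) = v_pair m k s t w"
  shows "is_v_pair m k s t w v \<beta>"
  using theI'[OF ex1_v_pair[OF assms(1-3), of t]] assms(4)
  by (metis (no_types, lifting) case_prod_conv v_pair_def)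

lemma is_u_pair_u_pair:
  assumes "m \<ge> 1" "general_linear_position m s"
    and "orthonormal_basis k w (orthogonal_comp (direction_space m s))"
    and "(u, \<alpha>) = u_pair m k s t w"
  shows "is_u_pair m k s t w u \<alpha>"
  using theI'[OF ex1_u_pair[OF assms(1-3), of t]] assms(4)
  by (metis (no_types, lifting) case_prod_conv u_pair_def)

lemma orthonormal_basis_inner_sum:
  assumes "orthonormal_basis k w V" and "j \<in> {1..k}"
  shows "(\<Sum>i=1..k. y i *\<^sub>R w i) \<bullet> w j = y j"
proof -
  have "(\<Sum>i=1..k. y i *\<^sub>R w i) \<bullet> w j = (\<Sum>i=1..k. if i = j then y i else 0)"
    unfolding inner_sum_left
    by (rule sum.cong) (use assms in \<open>auto simp: orthonormal_basis_def\<close>)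
  then show ?thesis using assms(2) by simp
qed

lemma orthonormal_basis_inner_sum_self:
  assumes "orthonormal_basis k w V"
  shows "(\<Sum>j=1..k. y j *\<^sub>R w j) \<bullet> (\<Sum>j=1..k. y j *\<^sub>R w j) = (\<Sum>j=1..k. (y j)\<^sup>2)"
proof -
  have "(\<Sum>i=1..k. y i *\<^sub>R w i) \<bullet> (y j *\<^sub>R w j) = (y j)\<^sup>2" if "j \<in> {1..k}" for j
    using orthonormal_basis_inner_sum[OF assms that, of y]
    by (simp add: power2_eq_square)
  then show ?thesis
    by (subst inner_sum_right) (rule sum.cong[OF refl])
qed

text \<open>The difference of \<open>z\<close> and its projection \<open>?p\<close> lies in the span
  of the \<open>w j\<close> and is orthogonal to each of them, hence to itself.\<close>

lemma orthonormal_basis_expansion: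
  assumes "orthonormal_basis k w V" and "z \<in> V"
  shows "z = (\<Sum>j=1..k. (z \<bullet> w j) *\<^sub>R w j)"
proof -
  let ?p = "\<Sum>j=1..k. (z \<bullet> w j) *\<^sub>R w j"
  have V: "span (w ` {1..k}) = V"
    using assms(1) by (simp add: orthonormal_basis_def)
  have "?p \<in> span (w ` {1..k})"
    by (intro span_sum span_scale span_base) auto
  then have "z - ?p \<in> span (w ` {1..k})"
    using assms(2) unfolding V[symmetric] by (rule span_diff[rotated])
  moreover have "orthogonal (z - ?p) q" if q: "q \<in> w ` {1..k}" for q
    using q orthonormal_basis_inner_sum[OF assms(1), of _ "\<lambda>j. z \<bullet> w j"]
    by (auto simp: orthogonal_def inner_diff_left)
  ultimately have "orthogonal (z - ?p) (z - ?p)"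
    by (rule orthogonal_to_span)
  then show ?thesis by (simp add: orthogonal_def)
qed

lemma residual_eq_quadric:
  fixes s w :: "nat \<Rightarrow> real ^ 'n"
  assumes ob: "orthonormal_basis k w (orthogonal_comp (direction_space m s))"
    and v: "is_v_pair m k s t w v \<beta>" and u: "is_u_pair m k s t w u \<alpha>"
    and i: "i \<in> {1..m}"
    and x: "x = v + b *\<^sub>R u + (\<Sum>j=1..k. y j *\<^sub>R w j)"
  shows "(norm (s i - x))\<^sup>2 - (t i - b)\<^sup>2 = quadric k u \<alpha> v \<beta> b y"
proof -
  define z where "z = (\<Sum>j=1..k. y j *\<^sub>R w j)"
  have sv: "2 * (s i \<bullet> v) = s i \<bullet> s i - (t i)\<^sup>2 + \<beta>"
    using v i by (auto simp: is_v_pair_def power2_norm_eq_inner algebra_simps)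
  have su: "s i \<bullet> u = t i + \<alpha>"
    using u i by (auto simp: is_u_pair_def algebra_simps)
  \<comment> \<open>Both \<open>v\<close> and \<open>s i\<close> have inner product
    \<open>offset s w j\<close> with \<open>w j\<close>; for \<open>s i\<close> this holds at every
    index by \<open>offset_eq\<close>.\<close>
  have vz: "v \<bullet> z = s i \<bullet> z"
    using v offset_eq[OF ob i]
    by (simp add: z_def inner_sum_right is_v_pair_def)
  have uz: "u \<bullet> z = 0"
    using u by (simp add: z_def inner_sum_right is_u_pair_def)
  have zz: "z \<bullet> z = (\<Sum>j=1..k. (y j)\<^sup>2)"
    unfolding z_def by (rule orthonormal_basis_inner_sum_self[OF ob])
  have "(norm (s i - x))\<^sup>2 = s i \<bullet> s i - 2 * (s i \<bullet> v) - 2 * b * (s i \<bullet> u) - 2 * (s i \<bullet> z)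
      + v \<bullet> v + b\<^sup>2 * (u \<bullet> u) + z \<bullet> z + 2 * b * (u \<bullet> v) + 2 * (v \<bullet> z) + 2 * b * (u \<bullet> z)"
    unfolding x z_def[symmetric] power2_norm_eq_inner
    by (simp add: inner_simps inner_commute power2_eq_square algebra_simps)
  \<comment> \<open>The \<open>b\<^sup>2\<close> of \<open>(t i - b)\<^sup>2\<close> supplies the
    \<open>- 1\<close> in the coefficient of \<open>b\<^sup>2\<close>, and
    \<open>2 * b * (s i \<bullet> u)\<close> leaves \<open>- 2 * \<alpha> * b\<close> once
    \<open>2 * b * t i\<close> has cancelled.\<close>
  then show ?thesis
    unfolding quadric_def sv su vz uz zz power2_norm_eq_inner
    by (simp add: power2_eq_square algebra_simps)
qed

lemma solution_diff_in_orthogonal_comp: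
  fixes s w :: "nat \<Rightarrow> real ^ 'n"
  assumes "m \<ge> 1"
    and v: "is_v_pair m k s t w v \<beta>" and u: "is_u_pair m k s t w u \<alpha>"
    and sol: "(b, x) \<in> sol_set m s t"
  shows "x - v - b *\<^sub>R u \<in> orthogonal_comp (direction_space m s)"
proof -
  let ?z = "x - v - b *\<^sub>R u"
  \<comment> \<open>Subtracting \<open>sv\<close> and \<open>2 * b\<close> times \<open>su\<close>
    from \<open>sx\<close> cancels \<open>s i \<bullet> s i\<close>, \<open>(t i)\<^sup>2\<close>
    and \<open>2 * b * t i\<close>, so the right-hand side is free of \<open>i\<close>.\<close>
  have const: "2 * (s i \<bullet> ?z) = x \<bullet> x - b\<^sup>2 - \<beta> - 2 * b * \<alpha>" if i: "i \<in> {1..m}" for i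
  proof -
    have sv: "2 * (s i \<bullet> v) = s i \<bullet> s i - (t i)\<^sup>2 + \<beta>"
      using v i by (auto simp: is_v_pair_def power2_norm_eq_inner algebra_simps)
    have su: "s i \<bullet> u = t i + \<alpha>"
      using u i by (auto simp: is_u_pair_def algebra_simps)
    have "(norm (s i - x))\<^sup>2 = (t i - b)\<^sup>2"
      using sol i by (auto simp: sol_set_def)
    then have "(s i - x) \<bullet> (s i - x) = (t i - b)\<^sup>2"
      by (simp only: power2_norm_eq_inner)
    then have sx: "2 * (s i \<bullet> x) = s i \<bullet> s i + x \<bullet> x - (t i)\<^sup>2 + 2 * b * t i - b\<^sup>2"
      by (simp add: inner_simps inner_commute power2_eq_square algebra_simps)
    have "2 * (s i \<bullet> ?z) = 2 * (s i \<bullet> x) - 2 * (s i \<bullet> v) - 2 * b * (s i \<bullet> u)"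
      by (simp add: inner_diff_right)
    then show ?thesis
      unfolding sx sv su by (simp add: algebra_simps)
  qed
  have gen: "orthogonal ?z (s i - s 1)" if "i \<in> {2..m}" for i
  proof -
    have "i \<in> {1..m}" "1 \<in> {1..m}" using that by auto
    then have "s i \<bullet> ?z = s 1 \<bullet> ?z" using const by (metis mult_cancel_left zero_neq_numeral)
    then show ?thesis
      unfolding orthogonal_def inner_commute[of ?z] inner_diff_left[of "s i"] by simp
  qed
  have "orthogonal ?z q" if "q \<in> direction_space m s" for q
    using that unfolding direction_space_def
    by (rule orthogonal_to_span) (use gen in blast)
  then show ?thesis
    by (auto simp: orthogonal_comp_def orthogonal_commute)
qed

theorem theorem2p1:
  fixes s w :: "nat \<Rightarrow> real ^ 'n" and t :: "nat \<Rightarrow> real"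
    and u v :: "real ^ 'n" and \<alpha> \<beta> :: real and m k :: nat
  assumes "1 \<le> m" and "m \<le> CARD('n) + 1"
    and "general_linear_position m s"
    and "k = CARD('n) + 1 - m"
    and "orthonormal_basis k w (orthogonal_comp (direction_space m s))"
    and "(v, \<beta>) = v_pair m k s t w"
    and "(u, \<alpha>) = u_pair m k s t w"
  shows "sol_set m s t =
    {(b, x). \<exists>y :: nat \<Rightarrow> real.
       x = v + b *\<^sub>R u + (\<Sum>j=1..k. y j *\<^sub>R w j) \<and> quadric k u \<alpha> v \<beta> b y = 0}"
proof -
  note v = is_v_pair_v_pair[OF assms(1,3,5,6)]
  note u = is_u_pair_u_pair[OF assms(1,3,5,7)]
  note residual = residual_eq_quadric[OF assms(5) v u]
  have "(b, x) \<in> sol_set m s t \<longleftrightarrow> (\<exists>y :: nat \<Rightarrow> real.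
      x = v + b *\<^sub>R u + (\<Sum>j=1..k. y j *\<^sub>R w j) \<and> quadric k u \<alpha> v \<beta> b y = 0)" for b x
  proof
    assume sol: "(b, x) \<in> sol_set m s t"
    \<comment> \<open>Orthonormality forces these coefficients.\<close>
    define y where "y j = (x - v - b *\<^sub>R u) \<bullet> w j" for j
    have "x - v - b *\<^sub>R u = (\<Sum>j=1..k. y j *\<^sub>R w j)"
      unfolding y_def by (rule orthonormal_basis_expansion[OF assms(5)
            solution_diff_in_orthogonal_comp[OF assms(1) v u sol]])
    then have x: "x = v + b *\<^sub>R u + (\<Sum>j=1..k. y j *\<^sub>R w j)"
      by (simp add: algebra_simps)
    moreover have "quadric k u \<alpha> v \<beta> b y = 0"
      \<comment> \<open>The residual has the same value at every index, so one equation suffices;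
        index 1 is available because \<open>1 \<le> m\<close>.\<close>
      using residual[OF _ x, of 1] sol assms(1) by (simp add: sol_set_def)
    ultimately show "\<exists>y. x = v + b *\<^sub>R u + (\<Sum>j=1..k. y j *\<^sub>R w j)
        \<and> quadric k u \<alpha> v \<beta> b y = 0" by blast
  next
    assume "\<exists>y. x = v + b *\<^sub>R u + (\<Sum>j=1..k. y j *\<^sub>R w j) \<and> quadric k u \<alpha> v \<beta> b y = 0"
    then obtain y where x: "x = v + b *\<^sub>R u + (\<Sum>j=1..k. y j *\<^sub>R w j)"
      and q: "quadric k u \<alpha> v \<beta> b y = 0" by blast
    have "(norm (s i - x))\<^sup>2 = (t i - b)\<^sup>2" if "i \<in> {1..m}" for i
      using residual[OF that x] q by simp
    then show "(b, x) \<in> sol_set m s t"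
      by (simp add: sol_set_def)
  qed
  then show ?thesis by auto
qed

end
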